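(* Let $F\in\mathbb{Z}[x]\setminus\{0\}$ have at least two distinct complex roots. Then the visibility density $D(F)=\lim_{N\to\infty}\#\mathrm{Visible}_F(N)/N^2$ exists and $D(F)=1$; equivalently, $\#\mathrm{Invisible}_F(N)=o(N^2)$ as $N\to\infty$.
   Context: For $F\in\mathbb{Z}[x]$, a point $(a,h)\in\mathbb{Z}_{>0}^2$ is called visible along $F$ if there is $t\in\mathbb{Q}$ with $h=tF(a)$ such that $a$ is the least positive integer $u$ for which $tF(u)$ is a positive integer. Otherwise $(a,h)$ is called invisible along $F$. For a positive integer $N$, write $[1,N]=\{n\in\mathbb{Z}:1\le n\le N\}$ and put $$\mathrm{Visible}_F(N)=\{(a,h)\in[1,N]^2:(a,h)\text{ is visible along }F\},$$ $$\mathrm{Invisible}_F(N)=\{(a,h)\in[1,N]^2:(a,h)\text{ is invisible along }F\}.$$ These two sets partition $[1,N]^2$. The visibility density of $F$ is $D(F)=\lim_{N\to\infty}\#\mathrm{Visible}_F(N)/N^2$, whenever the limit exists. *)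

theory Defs
  imports
    Complex_Main
    "HOL-Computational_Algebra.Polynomial"
    "HOL-Library.Landau_Symbols"
begin

definition pos_int_value :: "int poly \<Rightarrow> rat \<Rightarrow> int \<Rightarrow> bool" where
  "pos_int_value F t u \<longleftrightarrow>
     t * of_int (poly F u) \<in> \<int> \<and> 0 < t * of_int (poly F u)"

text \<open>
  The notions below concern points with positive integer coordinates, represented as
  pairs of integers; points outside the positive quadrant are neither visible nor invisible.
\<close>

definition visible_along :: "int poly \<Rightarrow> int \<times> int \<Rightarrow> bool" where
  "visible_along F = (\<lambda>(a, h). 0 < a \<and> 0 < h \<and>
     (\<exists>t::rat. of_int h = t * of_int (poly F a) \<and>
        pos_int_value F t a \<and> (\<forall>u>0. pos_int_value F t u \<longrightarrow> a \<le> u)))"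

definition invisible_along :: "int poly \<Rightarrow> int \<times> int \<Rightarrow> bool" where
  "invisible_along F = (\<lambda>(a, h). 0 < a \<and> 0 < h \<and> \<not> visible_along F (a, h))"

definition Visible :: "int poly \<Rightarrow> nat \<Rightarrow> (int \<times> int) set" where
  "Visible F N = {p \<in> {1..int N} \<times> {1..int N}. visible_along F p}"

definition Invisible :: "int poly \<Rightarrow> nat \<Rightarrow> (int \<times> int) set" where
  "Invisible F N = {p \<in> {1..int N} \<times> {1..int N}. invisible_along F p}"

definition visible_ratio :: "int poly \<Rightarrow> nat \<Rightarrow> real" where
  "visible_ratio F N = real (card (Visible F N)) / (real N)\<^sup>2"

text \<open>Only meaningful when the sequence of ratios converges.\<close>

definition visibility_density :: "int poly \<Rightarrow> real" where
  "visibility_density F = lim (visible_ratio F)"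

definition complex_roots :: "int poly \<Rightarrow> complex set" where
  "complex_roots F = {z. poly (map_poly of_int F) z = 0}"

end

theory Submission
  imports Defs "HOL-Computational_Algebra.Primes"
begin

text \<open>
  If \<open>(a, h)\<close> is invisible and \<open>a\<close> is large, then \<open>h * F b = k * F a\<close> for some \<open>0 < b < a\<close> and
  \<open>0 < k < h\<close>. Reducing \<open>k / h\<close> to lowest terms \<open>l / q\<close> gives \<open>l < q\<close>, a common divisor \<open>q\<close> of
  \<open>h\<close> and \<open>F a\<close>, and \<open>l * F a = q * F b\<close>.

  Large \<open>q\<close> are rare. Few pairs \<open>(a, h)\<close> admit a prime \<open>p > y\<close> dividing both \<open>h\<close> and \<open>F a\<close>, because
  \<open>F\<close> has at most \<open>degree F\<close> roots modulo \<open>p\<close> and the sum of \<open>1 / p\<^sup>2\<close> over \<open>p > y\<close> is small; and few \<open>h\<close>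
  are divisible by some \<open>n ^ k\<close> with \<open>2 \<le> n \<le> y\<close>. For all other pairs \<open>q\<close> divides \<open>(y!) ^ k\<close>.

  For each of the finitely many remaining \<open>l < q\<close>, the solutions \<open>a\<close> of \<open>l * F a = q * F b\<close> have
  density \<open>0\<close>. Measuring \<open>x = a - r\<close> and \<open>y = b - r\<close> from the centroid \<open>r\<close> of the roots, one has
  \<open>y = c * x + O(1 / x)\<close> with \<open>c = (l / q) ^ (1 / degree F) < 1\<close>. For irrational \<open>c\<close> the gaps between
  solutions tend to infinity, since \<open>c * g\<close> stays away from the integers for \<open>g\<close> in a bounded range.
  For rational \<open>c\<close>, also \<open>r\<close> being rational, \<open>y = c * x\<close> holds exactly for large \<open>a\<close>; infinitely many
  solutions would make \<open>F\<close> a constant multiple of a power of \<open>x - r\<close>.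
\<close>

section \<open>Common divisors\<close>

lemma finite_Collect_int_interval [simp]:
  fixes l u :: int
  shows "finite {x. l \<le> x \<and> x \<le> u \<and> P x}" "finite {x. l \<le> x \<and> x < u \<and> P x}"
  by (rule finite_subset[of _ "{l..u}"]; auto)+

text \<open>Lagrange's theorem. Dividing by \<open>x - c\<close>, for a root \<open>c\<close> modulo
  \<open>p\<close>, leaves a remainder divisible by \<open>p\<close>. As \<open>x - c\<close> is
  monic, the quotient keeps the leading coefficient, so the hypothesis survives the
  induction.\<close>

lemma card_roots_mod_prime_le:
  fixes f :: "int poly"
  assumes "prime p" "\<not> p dvd lead_coeff f"
  shows "card {x\<in>{0..<p}. p dvd poly f x} \<le> degree f"
  using assms(2)
proof (induction "degree f" arbitrary: f)
  case 0
  then obtain c where c: "f = [:c:]" by (metis degree_eq_zeroE)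
  with 0 show ?case by auto
next
  case (Suc n)
  show ?case
  proof (cases "{x\<in>{0..<p}. p dvd poly f x} = {}")
    case True
    then show ?thesis by (metis card.empty le0)
  next
    case False
    then obtain c where c: "c \<in> {0..<p}" "p dvd poly f c" by auto
    define g where "g = synthetic_div f c"
    have f: "f = [:-c, 1:] * g + [:poly f c:]"
      using synthetic_div_correct'[of c f] by (simp add: g_def)
    have dg: "degree g = n"
      using Suc.hyps(2) by (simp add: g_def degree_synthetic_div)
    have g0: "g \<noteq> 0"
      using Suc.hyps(2) by (auto simp: g_def synthetic_div_eq_0_iff)
    have "coeff f (Suc n) = lead_coeff g"
      by (subst f) (simp add: dg coeff_eq_0 flip: dg)
    then have "\<not> p dvd lead_coeff g"
      using Suc by simp
    then have IH: "card {x\<in>{0..<p}. p dvd poly g x} \<le> n"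
      using Suc.hyps(1)[of g] dg by simp
    have "{x\<in>{0..<p}. p dvd poly f x} \<subseteq> insert c {x\<in>{0..<p}. p dvd poly g x}"
    proof
      fix x assume x: "x \<in> {x\<in>{0..<p}. p dvd poly f x}"
      have "poly f x = (x - c) * poly g x + poly f c"
        by (subst f) (simp add: algebra_simps)
      with x c have "p dvd (x - c) * poly g x"
        by (metis (no_types, lifting) dvd_add_left_iff mem_Collect_eq)
      then consider "p dvd x - c" | "p dvd poly g x"
        using assms(1) prime_dvd_multD by blast
      then show "x \<in> insert c {x\<in>{0..<p}. p dvd poly g x}"
      proof cases
        case 1
        then have "x mod p = c mod p" by (simp add: mod_eq_dvd_iff)
        then show ?thesis using x c by auto
      qed (use x in auto)
    qed
    then have "card {x\<in>{0..<p}. p dvd poly f x} \<le> card (insert c {x\<in>{0..<p}. p dvd poly g x})"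
      by (intro card_mono) auto
    also have "\<dots> \<le> Suc (card {x\<in>{0..<p}. p dvd poly g x})"
      by (intro card_insert_le_m1) auto
    finally show ?thesis using IH Suc.hyps(2) by simp
  qed
qed

lemma card_mod_eq_le:
  fixes p r :: int
  assumes "p > 0"
  shows "card {a\<in>{1..int N}. a mod p = r} \<le> N div nat p + 1"
proof -
  have "inj_on (\<lambda>a. nat (a div p)) {a\<in>{1..int N}. a mod p = r}"
  proof (rule inj_onI)
    fix a b assume *: "a \<in> {a\<in>{1..int N}. a mod p = r}" "b \<in> {a\<in>{1..int N}. a mod p = r}"
      and "nat (a div p) = nat (b div p)"
    then have "a div p = b div p"
      using assms by (simp add: pos_imp_zdiv_nonneg_iff eq_nat_nat_iff)
    moreover have "a mod p = b mod p" using * by simp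
    ultimately show "a = b" by (metis div_mult_mod_eq)
  qed
  moreover have "(\<lambda>a. nat (a div p)) ` {a\<in>{1..int N}. a mod p = r} \<subseteq> {0..N div nat p}"
  proof clarsimp
    fix a assume "1 \<le> a" "a \<le> int N"
    then have "a div p \<le> int N div p" using assms by (intro zdiv_mono1) auto
    also have "\<dots> = int (N div nat p)" using assms by (simp add: zdiv_int)
    finally show "nat (a div p) \<le> N div nat p" by simp
  qed
  ultimately show ?thesis
    using card_inj_on_le[of _ _ "{0..N div nat p}"] by fastforce
qed

lemma card_multiples_le:
  fixes q :: int
  assumes "q > 0"
  shows "real (card {h\<in>{1..int N}. q dvd h}) \<le> real N / real_of_int q"
proof -
  have "{h\<in>{1..int N}. q dvd h} \<subseteq> (\<lambda>i. q * i) ` {1..int N div q}"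
  proof
    fix h assume "h \<in> {h\<in>{1..int N}. q dvd h}"
    then obtain i where i: "h = q * i" "1 \<le> q * i" "q * i \<le> int N" by auto
    then have "i \<ge> 1" using assms
      by (metis int_one_le_iff_zero_less zero_less_mult_pos)
    moreover have "i \<le> int N div q"
      using i assms by (metis nonzero_mult_div_cancel_left order_less_irrefl zdiv_mono1)
    ultimately show "h \<in> (\<lambda>i. q * i) ` {1..int N div q}" using i by auto
  qed
  then have "card {h\<in>{1..int N}. q dvd h} \<le> card {1..int N div q}"
    by (meson card_image_le card_mono finite_atLeastAtMost_int finite_imageI order_trans)
  also have "real \<dots> = of_int (int N div q)"
    using assms by (simp add: pos_imp_zdiv_nonneg_iff)
  also have "\<dots> \<le> real N / real_of_int q"
    by (metis floor_divide_of_int_eq of_int_floor_le of_int_of_nat_eq)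
  finally show ?thesis by simp
qed

lemma diff_dvd_poly_diff:
  fixes f :: "'a::comm_ring_1 poly"
  shows "x - y dvd poly f x - poly f y"
proof -
  have "poly f x = poly ([:- y, 1:] * synthetic_div f y + [:poly f y:]) x"
    by (simp only: synthetic_div_correct')
  then have "poly f x - poly f y = (x - y) * poly (synthetic_div f y) x"
    by (simp add: algebra_simps)
  then show ?thesis by simp
qed

text \<open>Whether \<open>p\<close> divides \<open>poly f a\<close> depends only on
  \<open>a mod p\<close>, so at most \<open>degree f\<close> residue classes are counted;
  \<open>+ 1\<close> is the rounding error of each class.\<close>

lemma card_poly_dvd_le:
  fixes f :: "int poly"
  assumes "prime p" "\<not> p dvd lead_coeff f" 
  shows "real (card {a\<in>{1..int N}. p dvd poly f a}) \<le> degree f * (real N / real_of_int p + 1)"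
proof -
  have p: "p > 0" using assms(1) by (simp add: prime_gt_0_int)
  define R where "R = {x\<in>{0..<p}. p dvd poly f x}"
  have R: "finite R" "card R \<le> degree f"
    using card_roots_mod_prime_le[OF assms] by (auto simp: R_def)
  have "{a\<in>{1..int N}. p dvd poly f a} \<subseteq> (\<Union>r\<in>R. {a\<in>{1..int N}. a mod p = r})"
  proof
    fix a assume a: "a \<in> {a\<in>{1..int N}. p dvd poly f a}"
    have "p dvd a - a mod p" by (simp add: dvd_minus_mod)
    also have "a - a mod p dvd poly f a - poly f (a mod p)"
      by (rule diff_dvd_poly_diff)
    finally have "p dvd poly f (a mod p)"
      using a by (simp add: dvd_diff_right_iff)
    then have "a mod p \<in> R" using p by (simp add: R_def)
    then show "a \<in> (\<Union>r\<in>R. {a\<in>{1..int N}. a mod p = r})" using a by auto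
  qed
  then have "card {a\<in>{1..int N}. p dvd poly f a} \<le> card (\<Union>r\<in>R. {a\<in>{1..int N}. a mod p = r})"
    using R(1) by (intro card_mono) auto
  also have "\<dots> \<le> (\<Sum>r\<in>R. card {a\<in>{1..int N}. a mod p = r})"
    by (rule card_UN_le[OF R(1)])
  also have "\<dots> \<le> (\<Sum>r\<in>R. N div nat p + 1)"
    by (intro sum_mono card_mod_eq_le p)
  also have "\<dots> \<le> degree f * (N div nat p + 1)"
    using mult_le_mono1[OF R(2), of "N div nat p + 1"] by simp
  also have "real \<dots> \<le> degree f * (real N / real_of_int p + 1)"
  proof -
    have "real (N div nat p) \<le> real N / real (nat p)" by (rule of_nat_div_le_of_nat)
    then have "real (N div nat p) + 1 \<le> real N / real_of_int p + 1" using p by simp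
    from mult_left_mono[OF this, of "real (degree f)"] show ?thesis by (simp add: algebra_simps)
  qed
  finally show ?thesis by simp
qed

section \<open>Rarity of large common divisors\<close>

lemma sum_inverse_squares_le:
  assumes "y > 0"
  shows "(\<Sum>n=Suc y..M. 1 / (real n)\<^sup>2) \<le> 1 / y"
proof (cases "y \<le> M")
  case True
  \<comment> \<open>Comparison with a telescoping sum; keeping \<open>- 1 / M\<close> in the claim
    makes the induction close.\<close>
  have "(\<Sum>n=Suc y..M. 1 / (real n)\<^sup>2) \<le> 1 / y - 1 / M"
    using True
  proof (induction M rule: dec_induct)
    case (step m)
    have "1 / (real (Suc m))\<^sup>2 \<le> 1 / m - 1 / Suc m"
      using assms step(1) by (simp add: divide_simps) (simp add: power2_eq_square algebra_simps)
    with step show ?case by simp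
  qed simp
  also have "\<dots> \<le> 1 / y" by simp
  finally show ?thesis .
qed simp

definition share_large_prime :: "int poly \<Rightarrow> nat \<Rightarrow> int \<times> int \<Rightarrow> bool" where
  "share_large_prime f y = (\<lambda>(a, h). \<exists>p. prime p \<and> int y < p \<and> p dvd poly f a \<and> p dvd h)"

text \<open>Union bound over the primes \<open>p\<close> with \<open>y < p\<close> and
  \<open>p \<le> N\<close>. Since \<open>y\<close> is at least the absolute value of the leading
  coefficient, no such prime divides it, and the count of roots modulo \<open>p\<close>
  applies.\<close>

lemma card_share_large_prime_le:
  fixes f :: "int poly"
  assumes "f \<noteq> 0" "y > 0" "\<bar>lead_coeff f\<bar> \<le> int y"
  shows "real (card {x\<in>{1..int N}\<times>{1..int N}. share_large_prime f y x}) \<le> 2 * degree f / y * (real N)\<^sup>2"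
proof -
  define S where "S p = {a\<in>{1..int N}. int p dvd poly f a} \<times> {h\<in>{1..int N}. int p dvd h}" for p
  define P where "P = {p\<in>{Suc y..N}. prime p}"
  have "{x\<in>{1..int N}\<times>{1..int N}. share_large_prime f y x} \<subseteq> (\<Union>p\<in>P. S p)"
  proof clarify
    fix a h assume ah: "a \<in> {1..int N}" "h \<in> {1..int N}" "share_large_prime f y (a, h)"
    then obtain p where p: "prime p" "int y < p" "p dvd poly f a" "p dvd h"
      by (auto simp: share_large_prime_def)
    have "p \<le> h" using p(4) ah by (intro zdvd_imp_le) auto
    moreover have "int (nat p) = p" "prime (nat p)" using p by (auto simp: prime_gt_0_int)
    ultimately show "(a, h) \<in> (\<Union>p\<in>P. S p)"
      using p ah by (intro UN_I[of "nat p"]) (auto simp: P_def S_def)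
  qed
  then have "card {x\<in>{1..int N}\<times>{1..int N}. share_large_prime f y x} \<le> card (\<Union>p\<in>P. S p)"
    by (intro card_mono) (auto simp: P_def S_def intro!: finite_cartesian_product)
  also have "\<dots> \<le> (\<Sum>p\<in>P. card (S p))"
    by (rule card_UN_le) (simp add: P_def)
  also have "real \<dots> = (\<Sum>p\<in>P. real (card (S p)))" by simp
  also have "\<dots> \<le> (\<Sum>p\<in>P. 2 * degree f * (real N)\<^sup>2 * (1 / (real p)\<^sup>2))"
  proof (rule sum_mono)
    fix p assume p: "p \<in> P"
    then have p0: "p > 0" "p \<le> N" "prime (int p)" by (auto simp: P_def)
    have ndvd: "\<not> int p dvd lead_coeff f"
    proof
      assume "int p dvd lead_coeff f"
      then have "int p \<le> \<bar>lead_coeff f\<bar>" using assms(1)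
        by (intro zdvd_imp_le) auto
      then show False using assms(3) p by (simp add: P_def)
    qed
    have "real (card (S p)) = real (card {a\<in>{1..int N}. int p dvd poly f a}) * real (card {h\<in>{1..int N}. int p dvd h})"
      by (simp add: S_def card_cartesian_product)
    also have "\<dots> \<le> (degree f * (real N / p + 1)) * (real N / p)"
      using card_poly_dvd_le[OF p0(3) ndvd, of N] card_multiples_le[of "int p" N] p0
      by (intro mult_mono) auto
    \<comment> \<open>Because \<open>p \<le> N\<close>, the rounding term \<open>1\<close> is at
      most \<open>N / p\<close>; this is the source of the factor 2.\<close>
    also have "\<dots> \<le> (degree f * (real N / p + real N / p)) * (real N / p)"
      using p0 by (intro mult_right_mono mult_left_mono add_left_mono) auto
    also have "\<dots> = 2 * degree f * (real N)\<^sup>2 * (1 / (real p)\<^sup>2)"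
      by (simp add: power2_eq_square field_simps)
    finally show "real (card (S p)) \<le> \<dots>" .
  qed
  also have "\<dots> = 2 * degree f * (real N)\<^sup>2 * (\<Sum>p\<in>P. 1 / (real p)\<^sup>2)"
    by (simp add: sum_distrib_left)
  also have "(\<Sum>p\<in>P. 1 / (real p)\<^sup>2) \<le> (\<Sum>p=Suc y..N. 1 / (real p)\<^sup>2)"
    by (rule sum_mono2) (auto simp: P_def)
  also have "\<dots> \<le> 1 / y" by (rule sum_inverse_squares_le[OF assms(2)])
  finally show ?thesis by (simp add: mult_left_mono)
qed

text \<open>A union bound over all bases up to \<open>y\<close> is affordable, since
  \<open>k\<close> will be chosen after \<open>y\<close> and \<open>2 ^ k\<close> can outgrow
  \<open>y\<close>.\<close>

definition divisible_by_power :: "nat \<Rightarrow> nat \<Rightarrow> int \<Rightarrow> bool" where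
  "divisible_by_power y k h \<longleftrightarrow> (\<exists>n\<in>{2..int y}. n ^ k dvd h)"

lemma card_divisible_by_power_le:
  "real (card {x\<in>{1..int N}\<times>{1..int N}. divisible_by_power y k (snd x)}) \<le> y / 2 ^ k * (real N)\<^sup>2"
proof -
  define S where "S n = {1..int N} \<times> {h\<in>{1..int N}. n ^ k dvd h}" for n
  have "{x\<in>{1..int N}\<times>{1..int N}. divisible_by_power y k (snd x)} \<subseteq> (\<Union>n\<in>{2..int y}. S n)"
    by (auto simp: divisible_by_power_def S_def)
  then have "card {x\<in>{1..int N}\<times>{1..int N}. divisible_by_power y k (snd x)} \<le> card (\<Union>n\<in>{2..int y}. S n)"
    by (intro card_mono) (auto simp: S_def intro!: finite_cartesian_product)
  also have "\<dots> \<le> (\<Sum>n\<in>{2..int y}. card (S n))"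
    by (rule card_UN_le) simp
  also have "real \<dots> = (\<Sum>n\<in>{2..int y}. real (card (S n)))" by simp
  also have "\<dots> \<le> (\<Sum>n\<in>{2..int y}. (real N)\<^sup>2 / 2 ^ k)"
  proof (rule sum_mono)
    fix n assume n: "n \<in> {2..int y}"
    have "real (card (S n)) = real N * real (card {h\<in>{1..int N}. n ^ k dvd h})"
      by (simp add: S_def card_cartesian_product)
    also have "\<dots> \<le> real N * (real N / real_of_int (n ^ k))"
      using n by (intro mult_left_mono card_multiples_le) auto
    also have "\<dots> \<le> real N * (real N / 2 ^ k)"
      using n by (intro mult_left_mono divide_left_mono) (auto intro!: power_mono)
    finally show "real (card (S n)) \<le> (real N)\<^sup>2 / 2 ^ k" by (simp add: power2_eq_square)
  qed
  also have "\<dots> \<le> y * ((real N)\<^sup>2 / 2 ^ k)"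
    by (simp add: mult_right_mono divide_right_mono)
  finally show ?thesis by simp
qed

text \<open>Comparison of multiplicities: a prime \<open>p\<close> dividing \<open>q\<close> is at
  most \<open>y\<close> and occurs in \<open>q\<close> fewer than \<open>k\<close> times, whereas
  \<open>p\<close> divides \<open>fact y\<close> and so occurs at least \<open>k\<close> times in
  its \<open>k\<close>-th power. The bound on \<open>q\<close> is thus independent of
  \<open>a\<close> and \<open>h\<close>.\<close>

lemma common_divisor_dvd_fact_power:
  assumes "\<not> share_large_prime f y (a, h)" "\<not> divisible_by_power y k h"
    and "q dvd poly f a" "q dvd h" "h \<noteq> 0"
  shows "q dvd (fact y) ^ k"
proof (rule multiplicity_le_imp_dvd)
  show "q \<noteq> 0" using assms by auto
next
  fix p :: int assume p: "prime p"
  show "multiplicity p q \<le> multiplicity p ((fact y) ^ k)"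
  proof (cases "p dvd q")
    case False
    then show ?thesis by (simp add: not_dvd_imp_multiplicity_0)
  next
    case True
    have "p dvd poly f a" "p dvd h"
      using True assms(3,4) by (blast intro: dvd_trans)+
    then have "p \<le> int y"
      using assms(1) p unfolding share_large_prime_def by (simp add: not_less) (meson not_le)
    then have "nat p dvd fact y"
      using prime_gt_0_int[OF p] by (intro dvd_fact) auto
    then have dvd: "p dvd fact y"
      using prime_gt_0_int[OF p] by (metis int_dvd_int_iff int_nat_eq less_imp_le of_nat_fact)
    have "p ^ multiplicity p q dvd h"
      using assms(4) multiplicity_dvd dvd_trans by blast
    then have "multiplicity p q < k" 
      using assms(2) \<open>p \<le> int y\<close> prime_ge_2_int[OF p]
      by (meson atLeastAtMost_iff divisible_by_power_def dvd_trans le_imp_power_dvd not_le)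
    moreover have "k \<le> multiplicity p ((fact y) ^ k)"
      using p dvd by (intro multiplicity_geI) (auto intro: dvd_power_same)
    ultimately show ?thesis by simp
  qed
qed

section \<open>Real asymptotics\<close>

lemma abs_poly_le:
  fixes p :: "real poly"
  assumes "degree p \<le> n" "\<bar>t\<bar> \<le> x" "1 \<le> x"
  shows "\<bar>poly p t\<bar> \<le> (\<Sum>i\<le>degree p. \<bar>coeff p i\<bar>) * x ^ n"
proof -
  have "\<bar>poly p t\<bar> \<le> (\<Sum>i\<le>degree p. \<bar>coeff p i * t ^ i\<bar>)"
    unfolding poly_altdef by (rule sum_abs)
  also have "\<dots> \<le> (\<Sum>i\<le>degree p. \<bar>coeff p i\<bar> * x ^ n)"
  proof (rule sum_mono)
    fix i assume "i \<in> {..degree p}"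
    then have "i \<le> n" using assms(1) by simp
    then have "\<bar>t\<bar> ^ i \<le> x ^ n"
      using assms(2,3) by (meson abs_ge_zero order_trans power_increasing power_mono)
    then show "\<bar>coeff p i * t ^ i\<bar> \<le> \<bar>coeff p i\<bar> * x ^ n"
      by (simp add: abs_mult power_abs mult_left_mono)
  qed
  finally show ?thesis by (simp add: sum_distrib_right)
qed

text \<open>This serves to remove the second highest coefficient by a shift (Tschirnhaus). The
  induction compares coefficients in \<open>a + (x + r) * p(x + r)\<close>.\<close>

lemma coeff_pcompose_shift:
  fixes p :: "'a::idom poly"
  assumes "degree p = Suc n"
  shows "coeff (pcompose p [:r, 1:]) n = coeff p n + of_nat (Suc n) * r * coeff p (Suc n)"
  using assms
proof (induction p arbitrary: n)
  case (pCons a p)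
  then have dp: "degree p = n" by (simp split: if_splits)
  show ?case
  proof (cases n)
    case 0
    then obtain b where "p = [:b:]" using dp by (metis degree_eq_zeroE)
    then show ?thesis using 0 by (simp add: pcompose_pCons)
  next
    case (Suc m)
    have "coeff (pcompose p [:r, 1:]) n = coeff p n"
      using lead_coeff_comp[of "[:r, 1:]" p] dp by (simp add: degree_pcompose)
    moreover have "coeff (pcompose p [:r, 1:]) m = coeff p m + of_nat (Suc m) * r * coeff p (Suc m)"
      using pCons.IH dp Suc by simp
    ultimately show ?thesis using Suc by (simp add: pcompose_pCons algebra_simps)
  qed
qed simp

text \<open>
  Without a term of degree \<open>n + 1\<close>, the polynomial \<open>G\<close> is its leading term up to a relative
  error of order \<open>x\<^sup>-\<^sup>2\<close>; this is why the error below tends to \<open>0\<close> and is not merely bounded.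
\<close>

lemma poly_ratio_asymptotics:
  fixes G :: "real poly" and c B :: real
  assumes deg: "degree G = Suc (Suc n)" and coeff0: "coeff G (Suc n) = 0"
    and c: "0 < c" "c < 1" and B: "B \<ge> 0"
  obtains C X where "X > 0" and
    "\<And>x y. X \<le> x \<Longrightarrow> - B \<le> y \<Longrightarrow> y \<le> x \<Longrightarrow>
       poly G y = c ^ Suc (Suc n) * poly G x \<Longrightarrow> \<bar>y - c * x\<bar> \<le> C / x"
proof -
  define d where "d = Suc (Suc n)"
  define A where "A = lead_coeff G"
  define H where "H = G - monom A d"
  define M where "M = (\<Sum>i\<le>degree H. \<bar>coeff H i\<bar>)"
  have A: "A \<noteq> 0" using deg by (metis A_def degree_0 leading_coeff_0_iff nat.distinct(1))
  have degH: "degree H \<le> n"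
  proof (rule degree_le, intro allI impI)
    fix i assume "n < i"
    then consider "i = Suc n" | "i = d" | "i > d" by (force simp: d_def)
    then show "coeff H i = 0"
      using coeff0 deg by cases (auto simp: H_def A_def d_def coeff_eq_0)
  qed
  have G: "poly G t = A * t ^ d + poly H t" for t
    by (simp add: H_def poly_monom)
  have M: "M \<ge> 0" by (simp add: M_def sum_nonneg)
  \<comment> \<open>\<open>K\<close> and \<open>X\<close> are made to exclude
    \<open>y \<le> 0\<close>, which would imply \<open>c ^ d * x\<^sup>2 \<le> K\<close>.
    \<open>C\<close> results from dividing the estimate \<open>main\<close> by
    \<open>(c * x) ^ Suc n\<close>.\<close>
  define K where "K = B ^ d + 2 * M / \<bar>A\<bar>"
  have K: "K \<ge> 0" using B M by (simp add: K_def)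
  define X where "X = max (max 1 B) (K / c ^ d + 1)"
  define C where "C = 2 * M / \<bar>A\<bar> / c ^ Suc n"
  show ?thesis
  proof
    show "X > 0" by (simp add: X_def)
  next
    fix x y assume "X \<le> x" and y: "- B \<le> y" "y \<le> x"
      and eq: "poly G y = c ^ Suc (Suc n) * poly G x"
    then have x: "1 \<le> x" "B \<le> x" "K / c ^ d < x" by (auto simp: X_def)
    have "A * (y ^ d - (c * x) ^ d) = c ^ d * poly H x - poly H y"
      using eq unfolding G d_def[symmetric] by (simp add: algebra_simps power_mult_distrib)
    also have "\<bar>\<dots>\<bar> \<le> c ^ d * \<bar>poly H x\<bar> + \<bar>poly H y\<bar>"
      using c by (simp add: abs_mult order_trans[OF abs_triangle_ineq4])
    also have "\<dots> \<le> 1 * (M * x ^ n) + M * x ^ n"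
      unfolding M_def using c x y degH
      by (intro add_mono mult_mono abs_poly_le) (auto intro: power_le_one)
    finally have "\<bar>A\<bar> * \<bar>y ^ d - (c * x) ^ d\<bar> \<le> 2 * M * x ^ n"
      by (simp add: abs_mult)
    then have main: "\<bar>y ^ d - (c * x) ^ d\<bar> \<le> 2 * M / \<bar>A\<bar> * x ^ n"
      using A by (simp add: field_simps)
    \<comment> \<open>For even \<open>d\<close> the powers alone would also allow \<open>y\<close>
      close to \<open>- c * x\<close>; the lower bound \<open>- B \<le> y\<close> rules this out for
      large \<open>x\<close>.\<close>
    have "y > 0"
    proof (rule ccontr)
      assume "\<not> y > 0"
      then have "\<bar>y ^ d\<bar> \<le> B ^ d" using y by (auto simp: power_abs intro: power_mono)
      also have "\<dots> \<le> B ^ d * x ^ n" using B x by (simp add: mult_le_cancel_left1)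
      finally have "(c * x) ^ d \<le> K * x ^ n"
        using main by (simp add: K_def algebra_simps)
      then have "c ^ d * x\<^sup>2 \<le> K"
        using x by (simp add: d_def power_mult_distrib power2_eq_square mult_ac)
      then have "x * x \<le> K / c ^ d" using c by (simp add: field_simps power2_eq_square)
      moreover have "x \<le> x * x" using x by simp
      ultimately show False using x by linarith
    qed
    \<comment> \<open>All terms of the cofactor are nonnegative, and the one with
      \<open>p = 0\<close> alone is \<open>(c * x) ^ Suc n\<close>.\<close>
    have "y ^ d - (c * x) ^ d = (y - c * x) * (\<Sum>p<d. y ^ p * (c * x) ^ (Suc n - p))"
      unfolding d_def by (rule diff_power_eq_sum)
    moreover have "(c * x) ^ Suc n \<le> (\<Sum>p<d. y ^ p * (c * x) ^ (Suc n - p))"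
      using member_le_sum[of 0 "{..<d}" "\<lambda>p. y ^ p * (c * x) ^ (Suc n - p)"] \<open>y > 0\<close> c x
      by (simp add: d_def)
    ultimately have "\<bar>y - c * x\<bar> * (c * x) ^ Suc n \<le> \<bar>y ^ d - (c * x) ^ d\<bar>"
      using c x by (auto simp: abs_mult intro!: mult_left_mono)
    also note main
    finally have "(\<bar>y - c * x\<bar> * x * c ^ Suc n) * x ^ n \<le> (2 * M / \<bar>A\<bar>) * x ^ n"
      by (simp add: power_mult_distrib mult_ac)
    then have "\<bar>y - c * x\<bar> * x * c ^ Suc n \<le> 2 * M / \<bar>A\<bar>"
      by (rule mult_right_le_imp_le) (use x in simp)
    then have "\<bar>y - c * x\<bar> * x \<le> C"
      unfolding C_def using c by (simp only: pos_le_divide_eq zero_less_power)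
    then show "\<bar>y - c * x\<bar> \<le> C / x"
      using x by (simp add: pos_le_divide_eq)
  qed
qed

text \<open>Beyond some \<open>m\<close> the derivative is at least its leading coefficient
  \<open>L > 0\<close>, so \<open>f\<close> increases with slope at least \<open>L\<close>; on
  \<open>[1, m]\<close> its absolute value is bounded by some \<open>M\<close>. For
  \<open>y > m\<close> monotonicity bounds \<open>poly f y\<close> below by \<open>poly f m\<close>,
  hence by \<open>- M\<close>.\<close>

lemma real_poly_eventually_dominates:
  fixes f :: "real poly"
  assumes "degree f > 0" "lead_coeff f > 0"
  obtains X where "\<And>x y. X \<le> x \<Longrightarrow> 1 \<le> y \<Longrightarrow> y < x \<Longrightarrow> \<bar>poly f y\<bar> < poly f x"
proof -
  define L where "L = lead_coeff (pderiv f)"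
  have "L > 0"
    using assms by (simp add: L_def degree_pderiv coeff_pderiv)
  then obtain x0 where x0: "\<And>x. x \<ge> x0 \<Longrightarrow> L \<le> poly (pderiv f) x"
    using poly_pinfty_gt_lc[of "pderiv f"] by (auto simp: L_def)
  define m where "m = max 1 x0"
  have growth: "poly f x \<ge> poly f y + L * (x - y)" if yx: "m \<le> y" "y < x" for x y
  proof -
    obtain z where z: "y < z" "z < x" "poly f x - poly f y = (x - y) * poly (pderiv f) z"
      using poly_MVT[OF yx(2), of f] by blast
    have "L * (x - y) \<le> poly (pderiv f) z * (x - y)"
      using x0[of z] z yx by (intro mult_right_mono) (auto simp: m_def)
    then show ?thesis using z(3) by (simp add: algebra_simps)
  qed
  define M where "M = (\<Sum>i\<le>degree f. \<bar>coeff f i\<bar>) * m ^ degree f"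
  have M: "\<bar>poly f y\<bar> \<le> M" if "1 \<le> y" "y \<le> m" for y
    unfolding M_def using that by (intro abs_poly_le) auto
  \<comment> \<open>Past \<open>X\<close> the growth from \<open>m\<close> to \<open>x\<close>
    exceeds \<open>2 * M + 1\<close>, which lifts \<open>poly f x\<close> from at least
    \<open>- M\<close> to above \<open>M\<close>.\<close>
  define X where "X = m + (2 * M + 1) / L + 1"
  show ?thesis
  proof
    fix x y assume xy: "X \<le> x" "1 \<le> y" "y < x"
    have "M \<ge> 0" using M[of 1] by (simp add: m_def)
    then have "m < x" using \<open>L > 0\<close> xy(1) by (simp add: X_def) (smt (verit) divide_nonneg_pos)
    have "(2 * M + 1) / L < x - m" using xy(1) by (simp add: X_def)
    then have "2 * M + 1 < L * (x - m)" using \<open>L > 0\<close> by (simp add: field_simps)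
    then have big: "M < poly f x"
      using growth[of m x] M[of m] \<open>m < x\<close> by (simp add: m_def)
    show "\<bar>poly f y\<bar> < poly f x"
    proof (cases "y \<le> m")
      case True
      then show ?thesis using big M[of y] xy by simp
    next
      case False
      then have "poly f y < poly f x"
        using growth[of y x] xy \<open>L > 0\<close> by (smt (verit) mult_pos_pos)
      moreover have "poly f m \<le> poly f y"
        using growth[of m y] False \<open>L > 0\<close> by (smt (verit) mult_pos_pos)
      ultimately show ?thesis using big M[of m] by (simp add: m_def)
    qed
  qed
qed

lemma poly_map_poly_of_int:
  "poly (map_poly of_int F) (of_int a) = (of_int (poly F a) :: 'a::comm_ring_1)"
  by (induction F) (simp_all add: map_poly_pCons)

text \<open>Needed to get \<open>k < h\<close> from \<open>h * F b = k * F a\<close>. Multiplication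
  by the sign of the leading coefficient reduces it to the real case.\<close>

lemma int_poly_eventually_dominates:
  fixes F :: "int poly"
  assumes "degree F > 0"
  obtains A where "\<And>a b. A \<le> a \<Longrightarrow> 0 < b \<Longrightarrow> b < a \<Longrightarrow> \<bar>poly F b\<bar> < \<bar>poly F a\<bar>"
proof -
  define s :: real where "s = sgn (of_int (lead_coeff F))"
  define f where "f = smult s (map_poly real_of_int F)"
  have s: "s \<noteq> 0" "\<bar>s\<bar> = 1" using assms by (auto simp: s_def sgn_if)
  have "lead_coeff f = \<bar>real_of_int (lead_coeff F)\<bar>"
    using s(1) by (simp add: f_def coeff_map_poly degree_map_poly) (simp add: s_def sgn_if)
  moreover have "lead_coeff F \<noteq> 0" using assms by auto
  ultimately have "degree f > 0" "lead_coeff f > 0"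
    using assms s by (auto simp: f_def degree_map_poly)
  then obtain X where X: "\<And>x y. X \<le> x \<Longrightarrow> 1 \<le> y \<Longrightarrow> y < x \<Longrightarrow> \<bar>poly f y\<bar> < poly f x"
    using real_poly_eventually_dominates by blast
  have f: "\<bar>poly f (of_int a)\<bar> = of_int \<bar>poly F a\<bar>" for a
    using s by (simp add: f_def poly_map_poly_of_int abs_mult)
  show ?thesis
  proof
    fix a b assume ab: "\<lceil>X\<rceil> \<le> a" "0 < b" "b < a"
    then have "\<bar>poly f (of_int b)\<bar> < \<bar>poly f (of_int a)\<bar>"
      using X[of "of_int a" "of_int b"] by (simp add: ceiling_le_iff)
    then show "\<bar>poly F b\<bar> < \<bar>poly F a\<bar>" unfolding f by linarith
  qed
qed

section \<open>Solutions of \<open>l * F a = q * F b\<close>\<close>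

definition ratio_solutions :: "int poly \<Rightarrow> int \<Rightarrow> int \<Rightarrow> int set" where
  "ratio_solutions F l q = {a. \<exists>b. 0 < b \<and> b < a \<and> l * poly F a = q * poly F b}"

lemma complex_roots_le_degree:
  assumes "F \<noteq> 0"
  shows "card (complex_roots F) \<le> degree F"
proof -
  have "map_poly of_int F \<noteq> (0 :: complex poly)" using assms by (simp add: map_poly_eq_0_iff)
  from card_poly_roots_bound[OF this] show ?thesis
    by (simp add: complex_roots_def degree_map_poly)
qed

text \<open>The real identity is carried over to the complex numbers by comparing both sides at the
  integers, which are infinitely many zeros of their difference. If \<open>A = 0\<close>, then
  \<open>F = 0\<close> and every complex number is a root.\<close>

lemma complex_roots_single:
  fixes A r :: real
  assumes "\<And>t::real. poly (map_poly of_int F) t = A * (t - r) ^ d"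
  shows "A = 0 \<or> complex_roots F \<subseteq> {of_real r}"
proof -
  define P where "P = map_poly of_int F - smult (of_real A) ([:- of_real r, 1:] ^ d :: complex poly)"
  have "poly P (of_int a) = 0" for a
  proof -
    have "of_int (poly F a) = (of_real (poly (map_poly of_int F) (of_int a)) :: complex)"
      by (simp add: poly_map_poly_of_int)
    also have "\<dots> = of_real A * (of_int a - of_real r) ^ d"
      unfolding assms by simp
    finally show ?thesis by (simp add: P_def poly_map_poly_of_int)
  qed
  then have "range of_int \<subseteq> {z. poly P z = 0}" by auto
  moreover have "infinite (range (of_int :: int \<Rightarrow> complex))"
    by (simp add: finite_image_iff inj_on_def infinite_UNIV_int)
  ultimately have "P = 0"
    using poly_roots_finite finite_subset by blast
  then have "map_poly of_int F = smult (of_real A) ([:- of_real r, 1:] ^ d :: complex poly)"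
    by (simp add: P_def)
  then show ?thesis by (auto simp: complex_roots_def)
qed

text \<open>The identity holds at infinitely many points, hence coefficientwise; for
  \<open>0 < c < 1\<close> the powers \<open>c ^ i\<close> are distinct, so only the top coefficient
  survives.\<close>

lemma homogeneous_polyI:
  fixes G :: "real poly"
  assumes c: "0 < c" "c < 1" and inf: "infinite {x. poly G (c * x) = c ^ degree G * poly G x}"
  shows "G = monom (lead_coeff G) (degree G)"
proof -
  define P where "P = pcompose G [:0, c:] - smult (c ^ degree G) G"
  have "{x. poly G (c * x) = c ^ degree G * poly G x} = {x. poly P x = 0}"
    by (simp add: P_def poly_pcompose mult.commute)
  with inf have "P = 0" using poly_roots_finite by metis
  then have coeffs: "c ^ i * coeff G i = c ^ degree G * coeff G i" for i
    by (metis P_def coeff_diff coeff_pcompose_linear coeff_smult eq_iff_diff_eq_0 coeff_0)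
  show ?thesis
  proof (rule poly_eqI)
    fix i
    consider "i < degree G" | "i = degree G" | "i > degree G" by linarith
    then show "coeff G i = coeff (monom (lead_coeff G) (degree G)) i"
    proof cases
      case 1
      then have "c ^ degree G < c ^ i" using c by (simp add: power_strict_decreasing)
      then have "coeff G i = 0" using coeffs[of i] by auto
      then show ?thesis using 1 by simp
    qed (auto simp: coeff_eq_0)
  qed
qed

lemma Rats_common_denominator:
  fixes x y :: real
  assumes "x \<in> \<rat>" "y \<in> \<rat>"
  obtains m :: int where "m > 0" "of_int m * x \<in> \<int>" "of_int m * y \<in> \<int>"
proof -
  obtain u v :: int where u: "v > 0" "x = of_int u / of_int v"
    using assms(1) by (metis Rats_cases')
  obtain s w :: int where s: "w > 0" "y = of_int s / of_int w"
    using assms(2) by (metis Rats_cases')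
  show ?thesis
  proof
    show "v * w > 0" using u s by simp
    have "of_int (v * w) * x = of_int (w * u)" using u by simp
    then show "of_int (v * w) * x \<in> \<int>" by (metis Ints_of_int)
    have "of_int (v * w) * y = of_int (v * s)" using s by simp
    then show "of_int (v * w) * y \<in> \<int>" by (metis Ints_of_int)
  qed
qed

text \<open>A gap statement covers both cases: for irrational \<open>c\<close> the gaps really grow,
  while for rational \<open>c\<close> the solutions are finite in number and the claim is vacuous
  beyond the last one.\<close>

lemma ratio_solutions_gaps:
  fixes F :: "int poly" and n :: nat
  assumes roots: "card (complex_roots F) \<ge> 2" and "F \<noteq> 0" and lq: "0 < l" "l < q"
  shows "\<exists>A0. \<forall>a\<in>ratio_solutions F l q. \<forall>a'\<in>ratio_solutions F l q.
           A0 \<le> a \<longrightarrow> a < a' \<longrightarrow> a + int n < a'"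
proof -
  obtain k where deg: "degree F = Suc (Suc k)"
    using complex_roots_le_degree[OF \<open>F \<noteq> 0\<close>] roots
    by (metis Suc_le_D le_trans numeral_2_eq_2 Suc_le_mono)
  define d where "d = Suc (Suc k)"
  define f where "f = map_poly real_of_int F"
  \<comment> \<open>The centroid of the roots, chosen to make \<open>coeff G (Suc k)\<close> vanish.
    It is rational, which the case of rational \<open>c\<close> uses.\<close>
  define r where "r = - coeff f (Suc k) / (of_nat d * coeff f d)"
  define G where "G = pcompose f [:r, 1:]"
  have degf: "degree f = d" using deg by (simp add: f_def d_def degree_map_poly)
  then have "coeff f d \<noteq> 0" by (metis d_def degree_0 leading_coeff_0_iff nat.distinct(1))
  moreover have "real d \<noteq> 0" by (simp add: d_def)
  ultimately have "real d * r * coeff f d = - coeff f (Suc k)"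
    unfolding r_def by (simp del: of_nat_eq_0_iff)
  then have G0: "coeff G (Suc k) = 0"
    using coeff_pcompose_shift[of f "Suc k" r] degf unfolding G_def d_def by simp
  have degG: "degree G = d" using degf by (simp add: G_def degree_pcompose)
  have G: "poly G (t - r) = poly f t" for t by (simp add: G_def poly_pcompose)
  define c where "c = root d (of_int l / of_int q)"
  have c: "0 < c" "c < 1" "c ^ d = of_int l / of_int q"
    using lq real_root_pow_pos2[of d "of_int l / of_int q"]
    unfolding c_def by (simp_all add: d_def real_root_lt_1_iff del: power_Suc)
  obtain C X where X: "X > 0" and CX:
    "\<And>x y. X \<le> x \<Longrightarrow> - \<bar>r\<bar> \<le> y \<Longrightarrow> y \<le> x \<Longrightarrow>
       poly G y = c ^ Suc (Suc k) * poly G x \<Longrightarrow> \<bar>y - c * x\<bar> \<le> C / x"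
    by (rule poly_ratio_asymptotics[OF degG[unfolded d_def] G0 c(1,2) abs_ge_zero[of r]]) (rule that)
  define w where "w = (\<lambda>a b. (of_int b - r) - c * (of_int a - r))"
  have sol: "\<exists>b. poly G (of_int b - r) = c ^ d * poly G (of_int a - r) \<and>
               (X \<le> of_int a - r \<longrightarrow> \<bar>w a b\<bar> \<le> C / (of_int a - r))"
    if a: "a \<in> ratio_solutions F l q" for a
  proof -
    obtain b where b: "0 < b" "b < a" "l * poly F a = q * poly F b"
      using a by (auto simp: ratio_solutions_def)
    have "of_int l * poly f (of_int a) = of_int q * poly f (of_int b)"
      using b(3) unfolding f_def poly_map_poly_of_int by (metis of_int_mult)
    then have *: "poly G (of_int b - r) = c ^ d * poly G (of_int a - r)"
      using lq unfolding G c(3) by (simp add: field_simps)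
    moreover have "- \<bar>r\<bar> \<le> of_int b - r" "of_int b - r \<le> of_int a - r" using b by auto
    ultimately show ?thesis using CX[of "of_int a - r" "of_int b - r"]
      by (auto simp: w_def d_def)
  qed
  show ?thesis
  proof (cases "c \<in> \<rat>")
    case False
    \<comment> \<open>The distances of \<open>c * g\<close> from the nearest integer for the
      forbidden gaps \<open>g\<close>; inserting 1 keeps the set nonempty when
      \<open>n = 0\<close>.\<close>
    define D where "D = insert 1 ((\<lambda>g. \<bar>c * of_int g - of_int (round (c * of_int g))\<bar>) ` {1..int n})"
    define \<delta> where "\<delta> = Min D"
    have "\<delta> \<in> D" unfolding \<delta>_def by (rule Min_in) (auto simp: D_def)
    have "\<delta> > 0"
    proof (rule ccontr)
      assume "\<not> \<delta> > 0"
      then obtain g where g: "g \<ge> 1" "c * of_int g = of_int (round (c * of_int g))"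
        using \<open>\<delta> \<in> D\<close> by (auto simp: D_def)
      then have "c = of_int (round (c * of_int g)) / of_int g" by (simp add: field_simps)
      with False show False by (metis Rats_divide Rats_of_int)
    qed
    \<comment> \<open>Chosen so that two errors of size \<open>C / (a - r)\<close> add up to less
      than \<open>\<delta>\<close>; the \<open>+ 1\<close> makes the inequality strict.\<close>
    define A0 where "A0 = \<lceil>max (X + r) (2 * C / \<delta> + r + 1)\<rceil>"
    have "a + int n < a'" if a: "a \<in> ratio_solutions F l q" "a' \<in> ratio_solutions F l q"
      and less: "A0 \<le> a" "a < a'" for a a'
    proof (rule ccontr)
      assume "\<not> a + int n < a'"
      then have g: "a' - a \<in> {1..int n}" using less by auto
      have big: "X \<le> of_int a - r" "2 * C / \<delta> < of_int a - r"
        using less(1) by (auto simp: A0_def ceiling_le_iff)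
      obtain b b' where b: "\<bar>w a b\<bar> \<le> C / (of_int a - r)" and b': "\<bar>w a' b'\<bar> \<le> C / (of_int a' - r)"
        using sol[OF a(1)] sol[OF a(2)] big less(2) by force
      \<comment> \<open>The asymptotics do not state the sign of \<open>C\<close>; it follows from
        the existence of a solution and makes \<open>C / x\<close> decreasing.\<close>
      have "C / (of_int a - r) \<ge> 0" using b by (meson abs_ge_zero order_trans)
      then have "C \<ge> 0" using big X by (simp add: zero_le_divide_iff)
      then have "C / (of_int a' - r) \<le> C / (of_int a - r)"
        using big X less by (intro divide_left_mono) auto
      then have "\<bar>w a b - w a' b'\<bar> \<le> 2 * C / (of_int a - r)" using b b' by simp
      also have "\<dots> < \<delta>" using big X \<open>\<delta> > 0\<close> by (simp add: field_simps)
      also have "\<delta> \<le> \<bar>c * of_int (a' - a) - of_int (round (c * of_int (a' - a)))\<bar>"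
        unfolding \<delta>_def D_def using g
        by (intro Min_le insertI2 image_eqI[where x = "a' - a"]) auto
      also have "\<dots> \<le> \<bar>c * of_int (a' - a) - of_int (b' - b)\<bar>"
        by (rule round_diff_minimal)
      also have "c * of_int (a' - a) - of_int (b' - b) = w a b - w a' b'"
        by (simp add: w_def algebra_simps)
      finally show False by simp
    qed
    then show ?thesis by blast
  next
    case True
    have "f = map_poly of_int F" by (simp add: f_def)
    then have "coeff f i \<in> \<rat>" for i by (simp add: coeff_map_poly)
    then have "r \<in> \<rat>" by (auto simp: r_def intro!: Rats_divide Rats_mult)
    then have "r * (1 - c) \<in> \<rat>" using True by (intro Rats_mult Rats_diff) auto
    then obtain m where m: "m > 0" "of_int m * c \<in> \<int>" "of_int m * (r * (1 - c)) \<in> \<int>"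
      using Rats_common_denominator True by metis
    define A0 where "A0 = \<lceil>max (X + r) (of_int m * C + r + 1)\<rceil>"
    have exact: "poly G (c * (of_int a - r)) = c ^ d * poly G (of_int a - r)"
      if a: "a \<in> ratio_solutions F l q" "A0 \<le> a" for a
    proof -
      have big: "X \<le> of_int a - r" "of_int m * C < of_int a - r"
        using a(2) by (auto simp: A0_def ceiling_le_iff)
      obtain b where b: "poly G (of_int b - r) = c ^ d * poly G (of_int a - r)"
        "\<bar>w a b\<bar> \<le> C / (of_int a - r)"
        using sol[OF a(1)] big by blast
      \<comment> \<open>\<open>m\<close> clears the denominators of \<open>c\<close> and
        \<open>r * (1 - c)\<close>, so \<open>m * w a b\<close> is an integer; being smaller than 1
        in absolute value, it is 0.\<close>
      have "of_int m * w a b = of_int m * of_int b - of_int m * c * of_int a - of_int m * (r * (1 - c))"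
        by (simp add: w_def algebra_simps)
      also have "\<dots> \<in> \<int>" using m by (intro Ints_diff Ints_mult[of "of_int m * c"] Ints_mult[of "of_int m" "of_int b"]) auto
      finally have int: "of_int m * w a b \<in> \<int>" .
      have "\<bar>of_int m * w a b\<bar> \<le> of_int m * (C / (of_int a - r))"
        using mult_left_mono[OF b(2), of "of_int m"] m(1) by (simp add: abs_mult)
      also have "\<dots> < 1" using big X by (simp add: field_simps)
      finally have "of_int m * w a b = 0" using int Ints_nonzero_abs_less1 by blast
      then have "of_int b - r = c * (of_int a - r)" using m(1) by (simp add: w_def)
      with b(1) show ?thesis by simp
    qed
    have "finite {a\<in>ratio_solutions F l q. A0 \<le> a}"
    proof (rule ccontr)
      assume inf: "infinite {a\<in>ratio_solutions F l q. A0 \<le> a}"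
      have "inj (\<lambda>a. of_int a - r)" by (simp add: inj_on_def)
      then have "infinite ((\<lambda>a. of_int a - r) ` {a\<in>ratio_solutions F l q. A0 \<le> a})"
        using inf finite_imageD inj_on_subset by blast
      moreover have "(\<lambda>a. of_int a - r) ` {a\<in>ratio_solutions F l q. A0 \<le> a}
          \<subseteq> {x. poly G (c * x) = c ^ degree G * poly G x}"
        using exact by (auto simp: degG)
      ultimately have "G = monom (lead_coeff G) d"
        using homogeneous_polyI[of c G] c(1,2) degG finite_subset by metis
      then have "poly f t = lead_coeff G * (t - r) ^ d" for t
        by (metis G poly_monom)
      then have "lead_coeff G = 0 \<or> complex_roots F \<subseteq> {of_real r}"
        unfolding f_def by (rule complex_roots_single)
      moreover have "lead_coeff G \<noteq> 0" using degG
        by (metis d_def degree_0 leading_coeff_0_iff nat.distinct(1))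
      ultimately have "card (complex_roots F) \<le> 1"
        using card_mono[of "{complex_of_real r}" "complex_roots F"] by auto
      then show False using roots by simp
    qed
    then have "bdd_above {a\<in>ratio_solutions F l q. A0 \<le> a}"
      by (rule bdd_above_finite)
    then obtain A1 where A1: "\<And>a. a \<in> ratio_solutions F l q \<Longrightarrow> A0 \<le> a \<Longrightarrow> a \<le> A1"
      by (auto simp: bdd_above_def)
    \<comment> \<open>No solution lies beyond this threshold, so the gap property holds vacuously
      there.\<close>
    have "\<not> max A0 (A1 + 1) \<le> a" if "a \<in> ratio_solutions F l q" for a
      using A1[OF that] by linarith
    then show ?thesis by blast
  qed
qed

section \<open>Invisible points\<close>

text \<open>Beyond \<open>A0\<close>, each block of \<open>n\<close> consecutive integers on which
  \<open>a div n\<close> is constant contains at most one element of \<open>S\<close>.\<close>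

lemma card_gapped_le:
  fixes S :: "int set"
  assumes gaps: "\<And>a a'. a \<in> S \<Longrightarrow> a' \<in> S \<Longrightarrow> A0 \<le> a \<Longrightarrow> a < a' \<Longrightarrow> a + int n < a'" and "n > 0"
  shows "real (card (S \<inter> {1..int N})) \<le> real (nat A0) + 1 + real N / real n"
proof -
  define T where "T = S \<inter> {max 1 A0..int N}"
  have "inj_on (\<lambda>a. nat (a div int n)) T"
  proof (rule linorder_inj_onI)
    fix a a' assume *: "a < a'" "a \<in> T" "a' \<in> T"
    then have "a + int n < a'" using gaps by (simp add: T_def)
    then have "(a + int n) div int n \<le> a' div int n" by (intro zdiv_mono1) (use \<open>n > 0\<close> in auto)
    then have "a div int n < a' div int n" using \<open>n > 0\<close> by simp
    moreover have "0 \<le> a div int n" using * \<open>n > 0\<close> by (simp add: T_def pos_imp_zdiv_nonneg_iff)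
    ultimately show "nat (a div int n) \<noteq> nat (a' div int n)" by linarith
  qed auto
  moreover have "(\<lambda>a. nat (a div int n)) ` T \<subseteq> {0..N div n}"
  proof clarify
    fix a assume "a \<in> T"
    then have "a div int n \<le> int N div int n" using \<open>n > 0\<close> by (intro zdiv_mono1) (auto simp: T_def)
    also have "\<dots> = int (N div n)" by (simp add: zdiv_int)
    finally show "nat (a div int n) \<in> {0..N div n}" by simp
  qed
  ultimately have T: "card T \<le> N div n + 1"
    using card_inj_on_le[of _ T "{0..N div n}"] by fastforce
  have "S \<inter> {1..int N} \<subseteq> {1..A0} \<union> T" by (auto simp: T_def)
  then have "card (S \<inter> {1..int N}) \<le> card ({1..A0} \<union> T)"
    by (intro card_mono) (auto simp: T_def)
  also have "\<dots> \<le> nat A0 + card T"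
    using card_Un_le[of "{1..A0}" T] by simp
  finally have "real (card (S \<inter> {1..int N})) \<le> real (nat A0) + 1 + real (N div n)"
    using T by linarith
  also have "real (N div n) \<le> real N / real n" by (rule of_nat_div_le_of_nat)
  finally show ?thesis by simp
qed

lemma eventually_const_le_linear:
  fixes c \<epsilon> :: real
  assumes "\<epsilon> > 0"
  shows "eventually (\<lambda>N. c \<le> \<epsilon> * real N) sequentially"
proof -
  have "eventually (\<lambda>N. c / \<epsilon> \<le> real N) sequentially"
    using filterlim_real_sequentially by (auto simp: filterlim_at_top)
  then show ?thesis
    by eventually_elim (use assms in \<open>simp add: field_simps\<close>)
qed

lemma ratio_solutions_sparse:
  fixes F :: "int poly"
  assumes "card (complex_roots F) \<ge> 2" "F \<noteq> 0" "0 < l" "l < q" "\<epsilon> > 0"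
  shows "eventually (\<lambda>N. real (card (ratio_solutions F l q \<inter> {1..int N})) \<le> \<epsilon> * real N) sequentially"
proof -
  \<comment> \<open>Gaps longer than \<open>n\<close> cost \<open>N / n\<close>, at most half of the
    allowance \<open>\<epsilon> * N\<close>; the other half absorbs the constant.\<close>
  obtain n :: nat where n: "2 / \<epsilon> < real n" using reals_Archimedean2 by blast
  moreover have "0 < 2 / \<epsilon>" using assms(5) by simp
  ultimately have "n > 0" by (cases n) auto
  obtain A0 where A0: "\<And>a a'. a \<in> ratio_solutions F l q \<Longrightarrow> a' \<in> ratio_solutions F l q \<Longrightarrow>
      A0 \<le> a \<Longrightarrow> a < a' \<Longrightarrow> a + int n < a'"
    using ratio_solutions_gaps[OF assms(1-4), of n] by blast
  have "eventually (\<lambda>N. real (nat A0) + 1 \<le> \<epsilon> / 2 * real N) sequentially"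
    using assms(5) by (intro eventually_const_le_linear) auto
  then show ?thesis
  proof eventually_elim
    case (elim N)
    have "real N / real n \<le> \<epsilon> / 2 * real N"
      using n \<open>n > 0\<close> assms(5) mult_left_mono[of "2 / \<epsilon>" "real n" "real N"] by (simp add: field_simps)
    moreover have "real (card (ratio_solutions F l q \<inter> {1..int N})) \<le> real (nat A0) + 1 + real N / real n"
      using A0 \<open>n > 0\<close> by (rule card_gapped_le)
    ultimately show ?case using elim by linarith
  qed
qed

lemma invisible_imp:
  assumes inv: "invisible_along F (a, h)"
    and dom: "\<And>b. 0 < b \<Longrightarrow> b < a \<Longrightarrow> \<bar>poly F b\<bar> < \<bar>poly F a\<bar>" and "poly F a \<noteq> 0"
  obtains l q where "0 < l" "l < q" "q dvd h" "q dvd poly F a" "a \<in> ratio_solutions F l q"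
proof -
  have pos: "0 < a" "0 < h" and nvis: "\<not> visible_along F (a, h)"
    using inv by (auto simp: invisible_along_def)
  \<comment> \<open>The only value of \<open>t\<close> compatible with \<open>h = t * F a\<close>,
    as \<open>F a\<close> is nonzero; invisibility then supplies a smaller \<open>b\<close>.\<close>
  define t :: rat where "t = of_int h / of_int (poly F a)"
  have t: "t * of_int (poly F a) = of_int h" using assms(3) by (simp add: t_def)
  then have "pos_int_value F t a" using pos by (simp add: pos_int_value_def)
  then obtain b where b: "0 < b" "b < a" "pos_int_value F t b"
    using nvis pos t by (force simp: visible_along_def)
  then obtain k where k: "t * of_int (poly F b) = of_int k" "0 < k"
    by (auto simp: pos_int_value_def elim: Ints_cases)
  have "(of_int (h * poly F b) :: rat) = of_int (k * poly F a)"
    using k(1) assms(3) by (simp add: t_def field_simps)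
  then have eq: "h * poly F b = k * poly F a" by (simp only: of_int_eq_iff)
  have "k < h"
  proof (rule ccontr)
    assume "\<not> k < h"
    then have "h * \<bar>poly F b\<bar> < k * \<bar>poly F a\<bar>"
      using dom[OF b(1,2)] pos k(2) by (intro mult_le_less_imp_less) auto
    moreover have "h * \<bar>poly F b\<bar> = k * \<bar>poly F a\<bar>"
      using arg_cong[OF eq, of abs] pos k(2) by (simp add: abs_mult)
    ultimately show False by simp
  qed
  define g where "g = gcd h k"
  have "g > 0" using k by (simp add: g_def)
  obtain q l where ql: "h = g * q" "k = g * l" "coprime q l"
    unfolding g_def using gcd_coprime_exists[of h k] k(2)
    by (metis gcd_eq_0_iff less_irrefl mult.commute)
  show ?thesis
  proof
    show "0 < l" "l < q" using k(2) \<open>k < h\<close> \<open>g > 0\<close> by (auto simp: ql zero_less_mult_iff)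
    show "q dvd h" by (simp add: ql)
    have eq': "q * poly F b = l * poly F a" using eq \<open>g > 0\<close> by (simp add: ql)
    \<comment> \<open>Lowest terms matter here: \<open>q\<close> divides \<open>l * F a\<close> and
      is coprime to \<open>l\<close>.\<close>
    then show "q dvd poly F a" by (metis coprime_dvd_mult_right_iff dvd_triv_left ql(3))
    show "a \<in> ratio_solutions F l q" using b eq' by (auto simp: ratio_solutions_def)
  qed
qed

text \<open>Four exceptional sets, each allowed \<open>\<epsilon> / 4\<close> of the square. The
  order of choice matters: \<open>y\<close> depends on \<open>\<epsilon>\<close>, \<open>k\<close>
  on \<open>y\<close>, and together they fix the finite set \<open>I\<close> of pairs
  \<open>(l, q)\<close> before \<open>N\<close> grows.\<close>

lemma Invisible_density_zero:
  fixes F :: "int poly"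
  assumes "F \<noteq> 0" and roots: "card (complex_roots F) \<ge> 2" and "\<epsilon> > 0"
  shows "eventually (\<lambda>N. real (card (Invisible F N)) \<le> \<epsilon> * (real N)\<^sup>2) sequentially"
proof -
  define d where "d = degree F"
  have "d > 0" using complex_roots_le_degree[OF assms(1)] roots by (simp add: d_def)
  obtain A where A: "\<And>a b. A \<le> a \<Longrightarrow> 0 < b \<Longrightarrow> b < a \<Longrightarrow> \<bar>poly F b\<bar> < \<bar>poly F a\<bar>"
    using int_poly_eventually_dominates \<open>d > 0\<close> unfolding d_def by blast
  \<comment> \<open>Any \<open>a > A1\<close> exceeds 1, so domination over \<open>b = 1\<close>
    shows that \<open>poly F a\<close> is nonzero.\<close>
  define A1 where "A1 = max 2 A"
  obtain y0 :: nat where y0: "8 * real d / \<epsilon> < real y0" using reals_Archimedean2 by blast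
  define y where "y = max (max 1 y0) (nat \<bar>lead_coeff F\<bar>)"
  have y: "y > 0" "\<bar>lead_coeff F\<bar> \<le> int y" "8 * real d / \<epsilon> < real y"
    using y0 by (auto simp: y_def)
  obtain k :: nat where k: "4 * real y / \<epsilon> < 2 ^ k"
    using real_arch_pow[of 2 "4 * real y / \<epsilon>"] by auto
  define K :: int where "K = fact y ^ k"
  have "K > 0" by (simp add: K_def)
  define I where "I = {(l, q). 0 < l \<and> l < q \<and> q \<le> K}"
  have "I \<subseteq> {0..K} \<times> {0..K}" by (auto simp: I_def)
  then have I: "finite I" by (rule finite_subset) simp
  \<comment> \<open>The allowance for each pair in \<open>I\<close>; the \<open>+ 1\<close> avoids
    division by zero if \<open>I\<close> is empty.\<close>
  define \<eta> where "\<eta> = \<epsilon> / (4 * (real (card I) + 1))"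
  have \<eta>: "\<eta> > 0" using assms(3) by (simp add: \<eta>_def field_simps add_pos_nonneg)
  have \<eta>I: "real (card I) * \<eta> \<le> \<epsilon> / 4" using assms(3) by (simp add: \<eta>_def field_simps)
  have "eventually (\<lambda>N. \<forall>x\<in>I. real (card (ratio_solutions F (fst x) (snd x) \<inter> {1..int N})) \<le> \<eta> * real N) sequentially"
    using I by (intro eventually_ball_finite ballI ratio_solutions_sparse roots assms(1) \<eta>) (auto simp: I_def)
  moreover have "eventually (\<lambda>N. real (nat A1) \<le> \<epsilon> / 4 * real N) sequentially"
    using assms(3) by (intro eventually_const_le_linear) auto
  ultimately show ?thesis
  proof eventually_elim
    case (elim N)
    define Q where "Q = {1..int N} \<times> {1..int N}"
    define B1 where "B1 = {1..A1} \<times> {1..int N}"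
    define B2 where "B2 = {x\<in>Q. share_large_prime F y x}"
    define B3 where "B3 = {x\<in>Q. divisible_by_power y k (snd x)}"
    define B4 where "B4 = (\<Union>x\<in>I. (ratio_solutions F (fst x) (snd x) \<inter> {1..int N}) \<times> {1..int N})"
    have fin: "finite B1" "finite B2" "finite B3" "finite B4"
      using I by (auto simp: B1_def B2_def B3_def B4_def Q_def)
    have "Invisible F N \<subseteq> B1 \<union> B2 \<union> B3 \<union> B4"
    proof (intro subsetI, rule ccontr)
      fix x assume "x \<in> Invisible F N" and "x \<notin> B1 \<union> B2 \<union> B3 \<union> B4"
      moreover obtain a h where "x = (a, h)" by (cases x)
      ultimately have "(a, h) \<in> Invisible F N"
        and notin: "(a, h) \<notin> B1" "(a, h) \<notin> B2" "(a, h) \<notin> B3" "(a, h) \<notin> B4" by auto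
      then have inv: "invisible_along F (a, h)" and Q: "(a, h) \<in> Q"
        by (auto simp: Invisible_def Q_def)
      then have "a > A1" using notin by (auto simp: B1_def Q_def)
      then have dom: "\<bar>poly F b\<bar> < \<bar>poly F a\<bar>" if "0 < b" "b < a" for b
        using A that by (simp add: A1_def)
      have "poly F a \<noteq> 0" using dom[of 1] \<open>a > A1\<close> by (auto simp: A1_def)
      then obtain l q where lq: "0 < l" "l < q" "q dvd h" "q dvd poly F a" "a \<in> ratio_solutions F l q"
        using invisible_imp[OF inv dom] by blast
      have "q dvd K" unfolding K_def
        using notin Q lq by (intro common_divisor_dvd_fact_power[of F y a h]) (auto simp: B2_def B3_def Q_def)
      then have "q \<le> K" using \<open>K > 0\<close> by (intro zdvd_imp_le)
      then have "(l, q) \<in> I" using lq by (simp add: I_def)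
      then show False using notin(4) lq Q by (auto simp: B4_def Q_def)
    qed
    then have "card (Invisible F N) \<le> card (B1 \<union> B2 \<union> B3 \<union> B4)"
      using fin by (intro card_mono) auto
    also have "\<dots> \<le> card B1 + card B2 + card B3 + card B4"
      by (intro order_trans[OF card_Un_le] add_right_mono order_refl)
    finally have "real (card (Invisible F N)) \<le> real (card B1) + real (card B2) + real (card B3) + real (card B4)"
      by linarith
    moreover have "real (card B1) \<le> \<epsilon> / 4 * (real N)\<^sup>2"
      using mult_right_mono[OF elim(2), of "real N"]
      by (simp add: B1_def card_cartesian_product power2_eq_square)
    moreover have "real (card B2) \<le> \<epsilon> / 4 * (real N)\<^sup>2"
    proof -
      have "2 * real d / real y \<le> \<epsilon> / 4"
        using y(1,3) assms(3) by (simp add: field_simps)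
      from mult_right_mono[OF this, of "(real N)\<^sup>2"]
      show ?thesis using card_share_large_prime_le[OF assms(1) y(1,2), of N]
        by (simp add: B2_def Q_def d_def)
    qed
    moreover have "real (card B3) \<le> \<epsilon> / 4 * (real N)\<^sup>2"
    proof -
      have "real y / 2 ^ k \<le> \<epsilon> / 4"
        using k assms(3) by (simp add: field_simps)
      then have "real y / 2 ^ k * (real N)\<^sup>2 \<le> \<epsilon> / 4 * (real N)\<^sup>2"
        by (rule mult_right_mono) simp
      moreover have "real (card B3) \<le> real y / 2 ^ k * (real N)\<^sup>2"
        unfolding B3_def Q_def by (rule card_divisible_by_power_le)
      ultimately show ?thesis by linarith
    qed
    moreover have "real (card B4) \<le> \<epsilon> / 4 * (real N)\<^sup>2"
    proof -
      have "card B4 \<le> (\<Sum>x\<in>I. card ((ratio_solutions F (fst x) (snd x) \<inter> {1..int N}) \<times> {1..int N}))"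
        unfolding B4_def by (rule card_UN_le[OF I])
      then have "real (card B4) \<le> (\<Sum>x\<in>I. real (card (ratio_solutions F (fst x) (snd x) \<inter> {1..int N})) * real N)"
        by (simp add: card_cartesian_product flip: of_nat_mult of_nat_sum)
      also have "\<dots> \<le> (\<Sum>x\<in>I. (\<eta> * real N) * real N)"
        using elim(1) by (intro sum_mono mult_right_mono) auto
      also have "\<dots> = (real (card I) * \<eta>) * (real N)\<^sup>2" by (simp add: power2_eq_square)
      also have "\<dots> \<le> \<epsilon> / 4 * (real N)\<^sup>2" by (intro mult_right_mono \<eta>I) auto
      finally show ?thesis .
    qed
    ultimately show ?case by (simp add: field_simps)
  qed
qed

lemma card_Visible_add_Invisible: "card (Visible F N) + card (Invisible F N) = N\<^sup>2"
proof -
  have "card (Visible F N) + card (Invisible F N) = card (Visible F N \<union> Invisible F N)"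
    by (rule card_Un_disjoint [symmetric])
      (auto simp: Visible_def Invisible_def invisible_along_def)
  also have "Visible F N \<union> Invisible F N = {1..int N} \<times> {1..int N}"
    by (auto simp: Visible_def Invisible_def invisible_along_def)
  finally show ?thesis by (simp add: card_cartesian_product power2_eq_square)
qed

theorem theorem1:
  fixes F :: "int poly"
  assumes "F \<noteq> 0"
    and "card (complex_roots F) \<ge> 2"
  shows "convergent (visible_ratio F) \<and> visibility_density F = 1 \<and>
    (\<lambda>N. real (card (Invisible F N))) \<in> o(\<lambda>N. (real N)\<^sup>2)"
proof -
  have small: "(\<lambda>N. real (card (Invisible F N))) \<in> o(\<lambda>N. (real N)\<^sup>2)"
    using Invisible_density_zero[OF assms] by (intro landau_o.smallI) simp
  have "(\<lambda>N. 1 - real (card (Invisible F N)) / (real N)\<^sup>2) \<longlonglongrightarrow> 1 - 0"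
    using smalloD_tendsto[OF small] by (intro tendsto_intros)
  \<comment> \<open>At \<open>N = 0\<close> division by zero gives 1 on the left and 0 on the right,
    hence the restriction to positive \<open>N\<close>.\<close>
  moreover have "eventually (\<lambda>N. 1 - real (card (Invisible F N)) / (real N)\<^sup>2 = visible_ratio F N) sequentially"
    using eventually_gt_at_top[of 0]
  proof eventually_elim
    case (elim N)
    have "real (card (Visible F N)) = (real N)\<^sup>2 - real (card (Invisible F N))"
      using arg_cong[OF card_Visible_add_Invisible[of F N], of real] by simp
    then show ?case using elim by (simp add: visible_ratio_def diff_divide_distrib)
  qed
  ultimately have "visible_ratio F \<longlonglongrightarrow> 1"
    by (simp add: tendsto_cong)
  then show ?thesis
    using small by (auto simp: convergent_def visibility_density_def limI)
qed

end
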